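(* Let $\mathcal{C}$ and $\mathcal{D}$ be categories and let $(F,G;\eta,\epsilon)$ be an adjoint pair, where $F\colon\mathcal{C}\to\mathcal{D}$ is left adjoint to $G\colon\mathcal{D}\to\mathcal{C}$, with unit $\eta\colon \mathrm{Id}_\mathcal{C}\to GF$ and counit $\epsilon\colon FG\to\mathrm{Id}_\mathcal{D}$. Let $M=(GF,\eta,G\epsilon F)$ be the monad on $\mathcal{C}$ defined by this adjoint pair, and let $K\colon\mathcal{D}\to M\text{-}\mathrm{Mod}_\mathcal{C}$ be the associated comparison functor. Then the functor $G$ is separable if and only if $M$ is a separable monad and $K$ is an equivalence up to retracts.
   Context: Separable functor: a functor $G\colon\mathcal{D}\to\mathcal{C}$ is separable if the natural transformation of bifunctors $\mathrm{Hom}_\mathcal{D}(-,-)\to\mathrm{Hom}_\mathcal{C}(G-,G-)$, $f\mapsto G(f)$, admits a retraction, i.e. there are maps $H_{X,Y}\colon\mathrm{Hom}_\mathcal{C}(G(X),G(Y))\to\mathrm{Hom}_\mathcal{D}(X,Y)$, natural in both $X$ and $Y$, with $H_{X,Y}(G(f))=f$ for every $f\colon X\to Y$. Monad: a triple $(M,\eta,\mu)$ with $M\colon\mathcal{C}\to\mathcal{C}$ an endofunctor and natural transformations $\eta\colon\mathrm{Id}_\mathcal{C}\to M$, $\mu\colon M^2\to M$ satisfying $\mu\circ M\mu=\mu\circ\mu M$ and $\mu\circ M\eta=\mathrm{Id}_M=\mu\circ\eta M$. Separable monad: a monad $(M,\eta,\mu)$ is separable if there is a natural transformation $\sigma\colon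 M\to M^2$ with $\mu\circ\sigma=\mathrm{Id}_M$ and $M\mu\circ\sigma M=\sigma\circ\mu=\mu M\circ M\sigma$. Modules: an $M$-module is a pair $(X,\lambda)$ with $X$ an object of $\mathcal{C}$ and $\lambda\colon M(X)\to X$ satisfying $\lambda\circ M(\lambda)=\lambda\circ\mu_X$ and $\lambda\circ\eta_X=\mathrm{Id}_X$. A morphism $(X,\lambda)\to(X',\lambda')$ is a morphism $f\colon X\to X'$ with $f\circ\lambda=\lambda'\circ M(f)$. These form the category $M\text{-}\mathrm{Mod}_\mathcal{C}$. Comparison functor: $K(D)=(G(D),G(\epsilon_D))$ on objects and $K(f)=G(f)$ on morphisms. Idempotent completion: for a category $\mathcal{C}$, the category $\mathcal{C}^\natural$ has as objects pairs $(X,e)$ with $e\colon X\to X$ idempotent, and as morphisms $(X,e)\to(X',e')$ the morphisms $f\colon X\to X'$ in $\mathcal{C}$ with $f=e'\circ f\circ e$. A functor $F\colon\mathcal{C}\to\mathcal{D}$ extends to $F^\natural\colon\mathcal{C}^\natural\to\mathcal{D}^\natural$ by $F^\natural(X,e)=(F(X),F(e))$, $F^\natural(f)=F(f)$. The functor $F$ is an equivalence up to retracts if $F^\natural$ is an equivalence of categories. *)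

theory Defs
  imports Main
begin

section \<open>Categories, functors and natural transformations\<close>

record ('o, 'm) cat =
  Obj :: "'o set"
  Hom :: "'o \<Rightarrow> 'o \<Rightarrow> 'm set"
  Ident :: "'o \<Rightarrow> 'm" ("\<one>\<index>")
  Comp :: "'m \<Rightarrow> 'm \<Rightarrow> 'm" (infixr "\<cdot>\<index>" 70)

text \<open>
  Hom-sets are pairwise disjoint (\<open>hom_disjoint\<close>), so a morphism determines its domain and
  codomain. This is why composition, and below the action of a functor on morphisms, need not be
  indexed by objects.
\<close>

locale category =
  fixes C :: "('o, 'm) cat" (structure)
  assumes hom_obj: "f \<in> Hom C X Y \<Longrightarrow> X \<in> Obj C \<and> Y \<in> Obj C"
    and hom_disjoint: "f \<in> Hom C X Y \<Longrightarrow> f \<in> Hom C X' Y' \<Longrightarrow> X = X' \<and> Y = Y'"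
    and id_hom: "X \<in> Obj C \<Longrightarrow> \<one> X \<in> Hom C X X"
    and comp_hom: "f \<in> Hom C X Y \<Longrightarrow> g \<in> Hom C Y Z \<Longrightarrow> g \<cdot> f \<in> Hom C X Z"
    and id_left: "f \<in> Hom C X Y \<Longrightarrow> \<one> Y \<cdot> f = f"
    and id_right: "f \<in> Hom C X Y \<Longrightarrow> f \<cdot> \<one> X = f"
    and assoc: "f \<in> Hom C W X \<Longrightarrow> g \<in> Hom C X Y \<Longrightarrow> h \<in> Hom C Y Z \<Longrightarrow>
      (h \<cdot> g) \<cdot> f = h \<cdot> (g \<cdot> f)"

record ('o1, 'm1, 'o2, 'm2) func =
  omap :: "'o1 \<Rightarrow> 'o2"
  amap :: "'m1 \<Rightarrow> 'm2"

locale is_functor = dom: category C + cod: category D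
  for C :: "('o1, 'm1) cat" and D :: "('o2, 'm2) cat" +
  fixes F :: "('o1, 'm1, 'o2, 'm2) func"
  assumes omap_obj: "X \<in> Obj C \<Longrightarrow> omap F X \<in> Obj D"
    and amap_hom: "f \<in> Hom C X Y \<Longrightarrow> amap F f \<in> Hom D (omap F X) (omap F Y)"
    and amap_id: "X \<in> Obj C \<Longrightarrow> amap F (\<one>\<^bsub>C\<^esub> X) = \<one>\<^bsub>D\<^esub> (omap F X)"
    and amap_comp: "f \<in> Hom C X Y \<Longrightarrow> g \<in> Hom C Y Z \<Longrightarrow>
      amap F (g \<cdot>\<^bsub>C\<^esub> f) = amap F g \<cdot>\<^bsub>D\<^esub> amap F f"

definition id_func :: "('o, 'm, 'o, 'm) func" where
  "id_func = \<lparr>omap = (\<lambda>X. X), amap = (\<lambda>f. f)\<rparr>"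

definition comp_func ::
  "('o2, 'm2, 'o3, 'm3) func \<Rightarrow> ('o1, 'm1, 'o2, 'm2) func \<Rightarrow> ('o1, 'm1, 'o3, 'm3) func"
  (infixr "\<circ>\<^sub>F" 75) where
  "G \<circ>\<^sub>F F = \<lparr>omap = (\<lambda>X. omap G (omap F X)), amap = (\<lambda>f. amap G (amap F f))\<rparr>"

locale nat_trans = src: is_functor C D F + tgt: is_functor C D G
  for C :: "('o1, 'm1) cat" and D :: "('o2, 'm2) cat" and F G +
  fixes t :: "'o1 \<Rightarrow> 'm2"
  assumes component: "X \<in> Obj C \<Longrightarrow> t X \<in> Hom D (omap F X) (omap G X)"
    and naturality: "f \<in> Hom C X Y \<Longrightarrow> t Y \<cdot>\<^bsub>D\<^esub> amap F f = amap G f \<cdot>\<^bsub>D\<^esub> t X"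

definition is_iso :: "('o, 'm) cat \<Rightarrow> 'o \<Rightarrow> 'o \<Rightarrow> 'm \<Rightarrow> bool" where
  "is_iso C X Y f \<longleftrightarrow> f \<in> Hom C X Y \<and>
    (\<exists>g \<in> Hom C Y X. g \<cdot>\<^bsub>C\<^esub> f = \<one>\<^bsub>C\<^esub> X \<and> f \<cdot>\<^bsub>C\<^esub> g = \<one>\<^bsub>C\<^esub> Y)"

definition nat_iso ::
  "('o1, 'm1) cat \<Rightarrow> ('o2, 'm2) cat \<Rightarrow> ('o1, 'm1, 'o2, 'm2) func \<Rightarrow> ('o1, 'm1, 'o2, 'm2) func \<Rightarrow>
    ('o1 \<Rightarrow> 'm2) \<Rightarrow> bool" where
  "nat_iso C D F G t \<longleftrightarrow> nat_trans C D F G t \<and>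
    (\<forall>X \<in> Obj C. is_iso D (omap F X) (omap G X) (t X))"

definition equivalence ::
  "('o1, 'm1) cat \<Rightarrow> ('o2, 'm2) cat \<Rightarrow> ('o1, 'm1, 'o2, 'm2) func \<Rightarrow> bool" where
  "equivalence C D F \<longleftrightarrow> is_functor C D F \<and>
    (\<exists>G s t. is_functor D C G \<and> nat_iso C C id_func (G \<circ>\<^sub>F F) s \<and> nat_iso D D (F \<circ>\<^sub>F G) id_func t)"


section \<open>Separable functors\<close>

definition separable_functor ::
  "('o1, 'm1) cat \<Rightarrow> ('o2, 'm2) cat \<Rightarrow> ('o1, 'm1, 'o2, 'm2) func \<Rightarrow> bool" where
  "separable_functor D C G \<longleftrightarrow> is_functor D C G \<and>
    (\<exists>H :: 'o1 \<Rightarrow> 'o1 \<Rightarrow> 'm2 \<Rightarrow> 'm1.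
      (\<forall>X \<in> Obj D. \<forall>Y \<in> Obj D. \<forall>h \<in> Hom C (omap G X) (omap G Y). H X Y h \<in> Hom D X Y) \<and>
      (\<forall>X' \<in> Obj D. \<forall>X \<in> Obj D. \<forall>Y \<in> Obj D.
        \<forall>a \<in> Hom D X' X. \<forall>h \<in> Hom C (omap G X) (omap G Y).
          H X' Y (h \<cdot>\<^bsub>C\<^esub> amap G a) = H X Y h \<cdot>\<^bsub>D\<^esub> a) \<and>
      (\<forall>X \<in> Obj D. \<forall>Y \<in> Obj D. \<forall>Y' \<in> Obj D.
        \<forall>b \<in> Hom D Y Y'. \<forall>h \<in> Hom C (omap G X) (omap G Y).
          H X Y' (amap G b \<cdot>\<^bsub>C\<^esub> h) = b \<cdot>\<^bsub>D\<^esub> H X Y h) \<and>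
      (\<forall>X \<in> Obj D. \<forall>Y \<in> Obj D. \<forall>f \<in> Hom D X Y. H X Y (amap G f) = f))"


section \<open>Monads and their modules\<close>

record ('o, 'm) monad =
  endo :: "('o, 'm, 'o, 'm) func"
  unit :: "'o \<Rightarrow> 'm"
  mult :: "'o \<Rightarrow> 'm"

text \<open>
  Equations between natural transformations are stated on components, with
  \<open>(M\<mu>)\<^sub>X = M(\<mu>\<^sub>X)\<close> and \<open>(\<mu>M)\<^sub>X = \<mu>\<^bsub>M X\<^esub>\<close>.
\<close>

locale is_monad = category C
  for C :: "('o, 'm) cat" (structure) +
  fixes M :: "('o, 'm) monad"
  assumes unit_nat: "nat_trans C C id_func (endo M) (unit M)"
    and mult_nat: "nat_trans C C (endo M \<circ>\<^sub>F endo M) (endo M) (mult M)"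
    and mult_assoc: "X \<in> Obj C \<Longrightarrow>
      mult M X \<cdot> amap (endo M) (mult M X) = mult M X \<cdot> mult M (omap (endo M) X)"
    and mult_endo_unit: "X \<in> Obj C \<Longrightarrow>
      mult M X \<cdot> amap (endo M) (unit M X) = \<one> (omap (endo M) X)"
    and mult_unit_endo: "X \<in> Obj C \<Longrightarrow>
      mult M X \<cdot> unit M (omap (endo M) X) = \<one> (omap (endo M) X)"

definition separable_monad :: "('o, 'm) cat \<Rightarrow> ('o, 'm) monad \<Rightarrow> bool" where
  "separable_monad C M \<longleftrightarrow> is_monad C M \<and>
    (\<exists>\<sigma>. nat_trans C C (endo M) (endo M \<circ>\<^sub>F endo M) \<sigma> \<and>
      (\<forall>X \<in> Obj C.
        mult M X \<cdot>\<^bsub>C\<^esub> \<sigma> X = \<one>\<^bsub>C\<^esub> (omap (endo M) X) \<and>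
        amap (endo M) (mult M X) \<cdot>\<^bsub>C\<^esub> \<sigma> (omap (endo M) X) = \<sigma> X \<cdot>\<^bsub>C\<^esub> mult M X \<and>
        \<sigma> X \<cdot>\<^bsub>C\<^esub> mult M X = mult M (omap (endo M) X) \<cdot>\<^bsub>C\<^esub> amap (endo M) (\<sigma> X)))"

text \<open>
  The same underlying morphism can be a morphism between several pairs of modules, so to keep
  hom-sets disjoint a morphism of modules is stored as \<open>(source, underlying morphism, target)\<close>.
  The idempotent completion below uses the same encoding.
\<close>

type_synonym ('a, 'm) tagged = "'a \<times> 'm \<times> 'a"

definition tagged_comp ::
  "('m \<Rightarrow> 'm \<Rightarrow> 'm) \<Rightarrow> ('a, 'm) tagged \<Rightarrow> ('a, 'm) tagged \<Rightarrow> ('a, 'm) tagged" where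
  "tagged_comp c = (\<lambda>(_, g, T) (S, f, _). (S, c g f, T))"

definition modules :: "('o, 'm) cat \<Rightarrow> ('o, 'm) monad \<Rightarrow> ('o \<times> 'm) set" where
  "modules C M = {(X, l). X \<in> Obj C \<and> l \<in> Hom C (omap (endo M) X) X \<and>
    l \<cdot>\<^bsub>C\<^esub> amap (endo M) l = l \<cdot>\<^bsub>C\<^esub> mult M X \<and> l \<cdot>\<^bsub>C\<^esub> unit M X = \<one>\<^bsub>C\<^esub> X}"

definition Mod ::
  "('o, 'm) cat \<Rightarrow> ('o, 'm) monad \<Rightarrow> ('o \<times> 'm, ('o \<times> 'm, 'm) tagged) cat" where
  "Mod C M =
    \<lparr>Obj = modules C M,
     Hom = (\<lambda>(X, l) (X', l'). {((X, l), f, (X', l')) | f.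
       (X, l) \<in> modules C M \<and> (X', l') \<in> modules C M \<and> f \<in> Hom C X X' \<and>
       f \<cdot>\<^bsub>C\<^esub> l = l' \<cdot>\<^bsub>C\<^esub> amap (endo M) f}),
     Ident = (\<lambda>(X, l). ((X, l), \<one>\<^bsub>C\<^esub> X, (X, l))),
     Comp = tagged_comp (Comp C)\<rparr>"


section \<open>Adjoint pairs\<close>

locale adjunction = left: category C + right: category D
  for C :: "('o1, 'm1) cat" and D :: "('o2, 'm2) cat" +
  fixes F :: "('o1, 'm1, 'o2, 'm2) func" and G :: "('o2, 'm2, 'o1, 'm1) func"
    and \<eta> :: "'o1 \<Rightarrow> 'm1" and \<epsilon> :: "'o2 \<Rightarrow> 'm2"
  assumes left_functor: "is_functor C D F"
    and right_functor: "is_functor D C G"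
    and unit_nat: "nat_trans C C id_func (G \<circ>\<^sub>F F) \<eta>"
    and counit_nat: "nat_trans D D (F \<circ>\<^sub>F G) id_func \<epsilon>"
    and triangle_left: "X \<in> Obj C \<Longrightarrow>
      \<epsilon> (omap F X) \<cdot>\<^bsub>D\<^esub> amap F (\<eta> X) = \<one>\<^bsub>D\<^esub> (omap F X)"
    and triangle_right: "Y \<in> Obj D \<Longrightarrow>
      amap G (\<epsilon> Y) \<cdot>\<^bsub>C\<^esub> \<eta> (omap G Y) = \<one>\<^bsub>C\<^esub> (omap G Y)"

definition adjunction_monad ::
  "('o1, 'm1, 'o2, 'm2) func \<Rightarrow> ('o2, 'm2, 'o1, 'm1) func \<Rightarrow> ('o1 \<Rightarrow> 'm1) \<Rightarrow> ('o2 \<Rightarrow> 'm2) \<Rightarrow>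
    ('o1, 'm1) monad" where
  "adjunction_monad F G \<eta> \<epsilon> =
    \<lparr>endo = G \<circ>\<^sub>F F, unit = \<eta>, mult = (\<lambda>X. amap G (\<epsilon> (omap F X)))\<rparr>"

text \<open>
  The tags of \<open>K(f)\<close> are the images under \<open>K\<close> of the domain and codomain of \<open>f\<close>. These are
  recovered from \<open>f\<close> by the following two functions, which are well defined on morphisms of a
  category because its hom-sets are disjoint.
\<close>

definition Dom :: "('o, 'm) cat \<Rightarrow> 'm \<Rightarrow> 'o" where
  "Dom C f = (THE X. \<exists>Y. f \<in> Hom C X Y)"

definition Cod :: "('o, 'm) cat \<Rightarrow> 'm \<Rightarrow> 'o" where
  "Cod C f = (THE Y. \<exists>X. f \<in> Hom C X Y)"

definition comparison ::
  "('o2, 'm2) cat \<Rightarrow> ('o2, 'm2, 'o1, 'm1) func \<Rightarrow> ('o2 \<Rightarrow> 'm2) \<Rightarrow>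
    ('o2, 'm2, 'o1 \<times> 'm1, ('o1 \<times> 'm1, 'm1) tagged) func" where
  "comparison D G \<epsilon> =
    (let K = (\<lambda>Y. (omap G Y, amap G (\<epsilon> Y)))
     in \<lparr>omap = K, amap = (\<lambda>f. (K (Dom D f), amap G f, K (Cod D f)))\<rparr>)"


section \<open>Idempotent completion\<close>

definition idempotents :: "('o, 'm) cat \<Rightarrow> ('o \<times> 'm) set" where
  "idempotents C = {(X, e). X \<in> Obj C \<and> e \<in> Hom C X X \<and> e \<cdot>\<^bsub>C\<^esub> e = e}"

definition idem_completion ::
  "('o, 'm) cat \<Rightarrow> ('o \<times> 'm, ('o \<times> 'm, 'm) tagged) cat" where
  "idem_completion C =
    \<lparr>Obj = idempotents C,
     Hom = (\<lambda>(X, e) (X', e'). {((X, e), f, (X', e')) | f.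
       (X, e) \<in> idempotents C \<and> (X', e') \<in> idempotents C \<and> f \<in> Hom C X X' \<and>
       f = e' \<cdot>\<^bsub>C\<^esub> f \<cdot>\<^bsub>C\<^esub> e}),
     Ident = (\<lambda>(X, e). ((X, e), e, (X, e))),
     Comp = tagged_comp (Comp C)\<rparr>"

definition idem_func ::
  "('o1, 'm1, 'o2, 'm2) func \<Rightarrow>
    ('o1 \<times> 'm1, ('o1 \<times> 'm1, 'm1) tagged, 'o2 \<times> 'm2, ('o2 \<times> 'm2, 'm2) tagged) func" where
  "idem_func F =
    (let F' = (\<lambda>(X, e). (omap F X, amap F e))
     in \<lparr>omap = F', amap = (\<lambda>(S, f, T). (F' S, amap F f, F' T))\<rparr>)"

definition equivalence_up_to_retracts ::
  "('o1, 'm1) cat \<Rightarrow> ('o2, 'm2) cat \<Rightarrow> ('o1, 'm1, 'o2, 'm2) func \<Rightarrow> bool" where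
  "equivalence_up_to_retracts C D F \<longleftrightarrow> is_functor C D F \<and>
    equivalence (idem_completion C) (idem_completion D) (idem_func F)"

end

theory Submission imports Defs begin

text \<open>
  Separability of the right adjoint \<open>G\<close> amounts to a natural section \<open>\<xi>\<close> of the counit. Given a
  natural retraction \<open>H\<close> of \<open>f \<mapsto> G f\<close>, the section is \<open>\<xi>\<^sub>Y = H(\<eta>\<^bsub>G Y\<^esub>)\<close>
  (\<open>separable_right_adjoint_imp_split_counit\<close>); from \<open>\<xi>\<close> everything on the right-hand side follows.
  The monad is split by \<open>\<sigma> = G\<xi>F\<close>. The comparison functor \<open>K\<close> is fully faithful, because
  \<open>h \<mapsto> \<epsilon>\<^sub>Y \<cdot> F h \<cdot> \<xi>\<^sub>X\<close> inverts it on morphisms \<open>K X \<rightarrow> K Y\<close>. And over a separable monad every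
  module \<open>(X, l)\<close> is a retract of the free module on \<open>X\<close>, which is \<open>K (F X)\<close>: the action \<open>l\<close> has
  the module section \<open>M l \<cdot> \<sigma>\<^sub>X \<cdot> \<eta>\<^sub>X\<close>. A fully faithful functor whose image reaches every object up
  to retracts becomes an equivalence after idempotent completion (\<open>equivalence_up_to_retractsI\<close>).

  Conversely, over a separable monad the forgetful functor from modules is separable: the same
  section turns any morphism \<open>h\<close> between underlying objects into the module morphism
  \<open>l' \<cdot> M h \<cdot> (M l \<cdot> \<sigma> \<cdot> \<eta>)\<close>, naturally, and fixes \<open>h\<close> if it is already linear (\<open>linearize\<close>). Now \<open>G\<close> is the
  forgetful functor after \<open>K\<close>, and \<open>K\<close> is fully faithful because its idempotent completion is, so
  lifting linearized morphisms along \<open>K\<close> gives a natural retraction for \<open>G\<close>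
  (\<open>separable_right_adjointI\<close>).
\<close>


section \<open>Calculating with morphisms\<close>

text \<open>
  With hom-sets the side conditions of associativity mention objects that do not occur in the terms
  being rewritten. Because hom-sets are disjoint they can be stated through \<open>Dom\<close> and \<open>Cod\<close>
  instead; the rules below then let the simplifier check composability by itself.
\<close>

definition arr :: "('o, 'm) cat \<Rightarrow> 'm \<Rightarrow> bool" where
  "arr C f \<longleftrightarrow> (\<exists>X Y. f \<in> Hom C X Y)"

context category
begin

lemma hom_iff: "f \<in> Hom C X Y \<longleftrightarrow> arr C f \<and> Dom C f = X \<and> Cod C f = Y"
proof -
  have "arr C f \<and> Dom C f = X \<and> Cod C f = Y" if f: "f \<in> Hom C X Y" for X Y
  proof -
    have "Dom C f = X" "Cod C f = Y"
      unfolding Dom_def Cod_def using f hom_disjoint by blast+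
    with f show ?thesis unfolding arr_def by blast
  qed
  then show ?thesis unfolding arr_def by blast
qed

lemma arr_obj [simp]: "arr C f \<Longrightarrow> Dom C f \<in> Obj C" "arr C f \<Longrightarrow> Cod C f \<in> Obj C"
  using hom_obj hom_iff by blast+

lemma arr_ident [simp]:
  assumes "X \<in> Obj C"
  shows "arr C (\<one> X)" "Dom C (\<one> X) = X" "Cod C (\<one> X) = X"
  using id_hom[OF assms] by (simp_all add: hom_iff)

lemma arr_comp [simp]:
  assumes "arr C f" "arr C g" "Cod C f = Dom C g"
  shows "arr C (g \<cdot> f)" "Dom C (g \<cdot> f) = Dom C f" "Cod C (g \<cdot> f) = Cod C g"
  using comp_hom[of f "Dom C f" "Cod C f" g "Cod C g"] assms by (simp_all add: hom_iff)

lemma comp_ident [simp]: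
  "arr C f \<Longrightarrow> Cod C f = X \<Longrightarrow> \<one> X \<cdot> f = f"
  "arr C f \<Longrightarrow> Dom C f = X \<Longrightarrow> f \<cdot> \<one> X = f"
  using id_left id_right hom_iff by blast+

lemma comp_assoc [simp]:
  "arr C f \<Longrightarrow> arr C g \<Longrightarrow> arr C h \<Longrightarrow> Cod C f = Dom C g \<Longrightarrow> Cod C g = Dom C h \<Longrightarrow>
    (h \<cdot> g) \<cdot> f = h \<cdot> (g \<cdot> f)"
  by (rule assoc) (auto simp: hom_iff)

text \<open>
  In right-associated normal form a rewrite rule for \<open>g \<cdot> f\<close> no longer matches \<open>g \<cdot> (f \<cdot> k)\<close>; this
  rule produces the version with a tail.
\<close>

lemma comp_tail:
  assumes "g \<cdot> f = h" "arr C f" "arr C g" "arr C k" "Cod C k = Dom C f" "Cod C f = Dom C g"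
  shows "g \<cdot> (f \<cdot> k) = h \<cdot> k"
  using assms by (metis comp_assoc)

lemma iso_cancel_left:
  assumes "is_iso C Y Z s" "f \<in> Hom C X Y" "g \<in> Hom C X Y" "s \<cdot> f = s \<cdot> g"
  shows "f = g"
proof -
  obtain r where r: "r \<in> Hom C Z Y" "r \<cdot> s = \<one> Y" and s: "s \<in> Hom C Y Z"
    using assms(1) unfolding is_iso_def by blast
  have "k = r \<cdot> (s \<cdot> k)" if "k \<in> Hom C X Y" for k
    using assoc[OF that s r(1)] r(2) id_left[OF that] by simp
  then show ?thesis using assms(2-4) by metis
qed

lemma iso_cancel_right:
  assumes "is_iso C X Y s" "f \<in> Hom C Y Z" "g \<in> Hom C Y Z" "f \<cdot> s = g \<cdot> s"
  shows "f = g"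
proof -
  obtain r where r: "r \<in> Hom C Y X" "s \<cdot> r = \<one> Y" and s: "s \<in> Hom C X Y"
    using assms(1) unfolding is_iso_def by blast
  have "k = (k \<cdot> s) \<cdot> r" if "k \<in> Hom C Y Z" for k
    using assoc[OF r(1) s that] r(2) id_right[OF that] by simp
  then show ?thesis using assms(2-4) by metis
qed

end

context is_functor
begin

lemma arr_amap [simp]:
  assumes "arr C f"
  shows "arr D (amap F f)" "Dom D (amap F f) = omap F (Dom C f)"
    "Cod D (amap F f) = omap F (Cod C f)"
  using amap_hom[of f "Dom C f" "Cod C f"] assms by (simp_all add: dom.hom_iff cod.hom_iff)

declare omap_obj [simp] amap_id [simp]

lemma amap_comp_arr [simp]:
  "arr C f \<Longrightarrow> arr C g \<Longrightarrow> Cod C f = Dom C g \<Longrightarrow> amap F (g \<cdot>\<^bsub>C\<^esub> f) = amap F g \<cdot>\<^bsub>D\<^esub> amap F f"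
  by (rule amap_comp) (auto simp: dom.hom_iff)

end

context nat_trans
begin

lemma arr_component [simp]:
  assumes "X \<in> Obj C"
  shows "arr D (t X)" "Dom D (t X) = omap F X" "Cod D (t X) = omap G X"
  using component[OF assms] by (simp_all add: src.cod.hom_iff)

lemma naturality_arr:
  "arr C f \<Longrightarrow> t (Cod C f) \<cdot>\<^bsub>D\<^esub> amap F f = amap G f \<cdot>\<^bsub>D\<^esub> t (Dom C f)"
  by (rule naturality) (auto simp: src.dom.hom_iff)

end

lemma id_func_simps [simp]: "omap id_func X = X" "amap id_func f = f"
  by (simp_all add: id_func_def)

lemma comp_func_simps [simp]:
  "omap (G \<circ>\<^sub>F F) X = omap G (omap F X)" "amap (G \<circ>\<^sub>F F) f = amap G (amap F f)"
  by (simp_all add: comp_func_def)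

lemma is_functor_id: "category C \<Longrightarrow> is_functor C C id_func"
  by (simp add: is_functor_def is_functor_axioms_def)

lemma is_functor_comp:
  assumes "is_functor C D F" "is_functor D E G"
  shows "is_functor C E (G \<circ>\<^sub>F F)"
proof -
  interpret F: is_functor C D F by fact
  interpret G: is_functor D E G by fact
  show ?thesis
    by unfold_locales (auto simp: F.dom.hom_iff F.cod.hom_iff G.cod.hom_iff)
qed


section \<open>Equivalences\<close>

definition fully_faithful ::
  "('o1, 'm1) cat \<Rightarrow> ('o2, 'm2) cat \<Rightarrow> ('o1, 'm1, 'o2, 'm2) func \<Rightarrow> bool" where
  "fully_faithful C D F \<longleftrightarrow>
    (\<forall>X \<in> Obj C. \<forall>Y \<in> Obj C. bij_betw (amap F) (Hom C X Y) (Hom D (omap F X) (omap F Y)))"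

lemma fully_faithfulI:
  assumes "is_functor C D F"
    and "\<And>X Y f g. f \<in> Hom C X Y \<Longrightarrow> g \<in> Hom C X Y \<Longrightarrow> amap F f = amap F g \<Longrightarrow> f = g"
    and "\<And>X Y h. X \<in> Obj C \<Longrightarrow> Y \<in> Obj C \<Longrightarrow> h \<in> Hom D (omap F X) (omap F Y) \<Longrightarrow>
      \<exists>f \<in> Hom C X Y. amap F f = h"
  shows "fully_faithful C D F"
  unfolding fully_faithful_def bij_betw_def inj_on_def
  using assms is_functor.amap_hom[OF assms(1)] by (auto simp: image_iff) metis

lemma fully_faithful_faithful:
  assumes "fully_faithful C D F" "category C" "f \<in> Hom C X Y" "g \<in> Hom C X Y" "amap F f = amap F g"
  shows "f = g"
  using assms category.hom_obj[of C] unfolding fully_faithful_def bij_betw_def inj_on_def by metis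

lemma fully_faithful_full:
  assumes "fully_faithful C D F" "X \<in> Obj C" "Y \<in> Obj C" "h \<in> Hom D (omap F X) (omap F Y)"
  obtains f where "f \<in> Hom C X Y" "amap F f = h"
  using assms unfolding fully_faithful_def bij_betw_def by (metis imageE)

definition hom_lift ::
  "('o1, 'm1) cat \<Rightarrow> ('o1, 'm1, 'o2, 'm2) func \<Rightarrow> 'o1 \<Rightarrow> 'o1 \<Rightarrow> 'm2 \<Rightarrow> 'm1" where
  "hom_lift C F X Y = inv_into (Hom C X Y) (amap F)"

lemma hom_lift:
  assumes "fully_faithful C D F" "X \<in> Obj C" "Y \<in> Obj C" "h \<in> Hom D (omap F X) (omap F Y)"
  shows "hom_lift C F X Y h \<in> Hom C X Y" "amap F (hom_lift C F X Y h) = h"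
  using assms unfolding fully_faithful_def bij_betw_def hom_lift_def
  by (metis inv_into_into, metis f_inv_into_f)

text \<open>
  Let \<open>G\<close> be a quasi-inverse with \<open>s : Id \<cong> G F\<close> and \<open>t : F G \<cong> Id\<close>. Each of \<open>F\<close> and \<open>G\<close> is faithful
  because the composite is conjugation by \<open>s\<close> or \<open>t\<close>. A morphism \<open>h : F X \<rightarrow> F Y\<close> is the image of
  \<open>s\<^sub>Y\<^sup>-\<^sup>1 \<cdot> G h \<cdot> s\<^sub>X\<close>, since both have the same image under the faithful functor \<open>G\<close>.
\<close>

lemma equivalence_imp_fully_faithful:
  assumes "equivalence C D F"
  shows "fully_faithful C D F"
proof -
  obtain G s t where F: "is_functor C D F" and G: "is_functor D C G"
    and s: "nat_iso C C id_func (G \<circ>\<^sub>F F) s" and t: "nat_iso D D (F \<circ>\<^sub>F G) id_func t"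
    using assms unfolding equivalence_def by blast
  interpret F: is_functor C D F by fact
  interpret G: is_functor D C G by fact
  interpret s: nat_trans C C id_func "G \<circ>\<^sub>F F" s using s by (simp add: nat_iso_def)
  interpret t: nat_trans D D "F \<circ>\<^sub>F G" id_func t using t by (simp add: nat_iso_def)
  have s_iso: "is_iso C X (omap G (omap F X)) (s X)" if "X \<in> Obj C" for X
    using s that by (simp add: nat_iso_def)
  have t_iso: "is_iso D (omap F (omap G X)) X (t X)" if "X \<in> Obj D" for X
    using t that by (simp add: nat_iso_def)
  have G_faithful: "f = g"
    if "f \<in> Hom D X Y" "g \<in> Hom D X Y" "amap G f = amap G g" for f g X Y
    using F.cod.iso_cancel_right[OF t_iso that(1,2)] t.naturality[OF that(1)]
      t.naturality[OF that(2)] that F.cod.hom_obj[OF that(1)] by simp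
  show ?thesis
  proof (rule fully_faithfulI[OF F])
    fix X Y f g
    assume fg: "f \<in> Hom C X Y" "g \<in> Hom C X Y" "amap F f = amap F g"
    then show "f = g"
      using F.dom.iso_cancel_left[OF s_iso fg(1,2)] s.naturality[OF fg(1)]
        s.naturality[OF fg(2)] F.dom.hom_obj[OF fg(1)] by simp
  next
    fix X Y h
    assume X: "X \<in> Obj C" and Y: "Y \<in> Obj C" and h: "h \<in> Hom D (omap F X) (omap F Y)"
    from s_iso[OF X] obtain sX' where sX': "sX' \<in> Hom C (omap G (omap F X)) X" "s X \<cdot>\<^bsub>C\<^esub> sX' = \<one>\<^bsub>C\<^esub> (omap G (omap F X))"
      by (auto simp: is_iso_def)
    from s_iso[OF Y] obtain sY' where sY': "sY' \<in> Hom C (omap G (omap F Y)) Y" "s Y \<cdot>\<^bsub>C\<^esub> sY' = \<one>\<^bsub>C\<^esub> (omap G (omap F Y))"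
      by (auto simp: is_iso_def)
    define f where "f = sY' \<cdot>\<^bsub>C\<^esub> amap G h \<cdot>\<^bsub>C\<^esub> s X"
    have f: "f \<in> Hom C X Y"
      using h sX'(1) sY'(1) X Y by (simp add: f_def F.dom.hom_iff F.cod.hom_iff)
    have s_f: "s Y \<cdot>\<^bsub>C\<^esub> f = amap G (amap F f) \<cdot>\<^bsub>C\<^esub> s X"
      using s.naturality[OF f] by simp
    have "amap G (amap F f) = (amap G (amap F f) \<cdot>\<^bsub>C\<^esub> s X) \<cdot>\<^bsub>C\<^esub> sX'"
      using f sX' X by (simp add: F.dom.hom_iff)
    also have "\<dots> = (s Y \<cdot>\<^bsub>C\<^esub> f) \<cdot>\<^bsub>C\<^esub> sX'"
      by (simp only: s_f)
    also have "\<dots> = (s Y \<cdot>\<^bsub>C\<^esub> sY') \<cdot>\<^bsub>C\<^esub> amap G h \<cdot>\<^bsub>C\<^esub> s X \<cdot>\<^bsub>C\<^esub> sX'"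
      using h sX'(1) sY'(1) X Y by (simp add: f_def F.dom.hom_iff F.cod.hom_iff)
    also have "\<dots> = amap G h"
      unfolding sX' sY' using h by (simp add: F.dom.hom_iff F.cod.hom_iff)
    finally have "amap F f = h"
      using G_faithful[OF F.amap_hom[OF f] h] by simp
    with f show "\<exists>f \<in> Hom C X Y. amap F f = h" by blast
  qed
qed

text \<open>
  Choose an isomorphism \<open>p\<^sub>Z : F (P Z) \<rightarrow> Z\<close> for each \<open>Z\<close>. The quasi-inverse sends \<open>h\<close> to the unique
  preimage of \<open>p\<^sup>-\<^sup>1 \<cdot> h \<cdot> p\<close>, and the unit at \<open>X\<close> is the preimage of the inverse of \<open>p\<^bsub>F X\<^esub>\<close>. All
  equations hold because they hold after applying the faithful functor \<open>F\<close>.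
\<close>

lemma fully_faithful_imp_equivalence:
  assumes F: "is_functor C D F" and ff: "fully_faithful C D F"
    and surj: "\<And>Z. Z \<in> Obj D \<Longrightarrow> \<exists>X \<in> Obj C. \<exists>p. is_iso D (omap F X) Z p"
  shows "equivalence C D F"
proof -
  interpret F: is_functor C D F by fact
  have "\<forall>Z. \<exists>X p p'. Z \<in> Obj D \<longrightarrow> X \<in> Obj C \<and> p \<in> Hom D (omap F X) Z \<and> p' \<in> Hom D Z (omap F X) \<and>
    p' \<cdot>\<^bsub>D\<^esub> p = \<one>\<^bsub>D\<^esub> (omap F X) \<and> p \<cdot>\<^bsub>D\<^esub> p' = \<one>\<^bsub>D\<^esub> Z"
    using surj unfolding is_iso_def by blast
  then obtain P p p' where
    P: "\<And>Z. Z \<in> Obj D \<Longrightarrow> P Z \<in> Obj C"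
      "\<And>Z. Z \<in> Obj D \<Longrightarrow> p Z \<in> Hom D (omap F (P Z)) Z"
      "\<And>Z. Z \<in> Obj D \<Longrightarrow> p' Z \<in> Hom D Z (omap F (P Z))"
    and p'p: "\<And>Z. Z \<in> Obj D \<Longrightarrow> p' Z \<cdot>\<^bsub>D\<^esub> p Z = \<one>\<^bsub>D\<^esub> (omap F (P Z))"
    and pp': "\<And>Z. Z \<in> Obj D \<Longrightarrow> p Z \<cdot>\<^bsub>D\<^esub> p' Z = \<one>\<^bsub>D\<^esub> Z"
    by metis
  have p_arr: "arr D (p Z)" "Dom D (p Z) = omap F (P Z)" "Cod D (p Z) = Z"
    "arr D (p' Z)" "Dom D (p' Z) = Z" "Cod D (p' Z) = omap F (P Z)" if "Z \<in> Obj D" for Z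
    using P(2,3)[OF that] by (simp_all add: F.cod.hom_iff)
  note p_simps = P(1) p_arr pp' p'p
  have eqI: "f = g" if "arr C f" "arr C g" "Dom C f = Dom C g" "Cod C f = Cod C g"
    "amap F f = amap F g" for f g
    using fully_faithful_faithful[OF ff F.dom.category_axioms] that F.dom.hom_iff by metis
  define G where "G = \<lparr>omap = P, amap = (\<lambda>h. hom_lift C F (P (Dom D h)) (P (Cod D h))
    (p' (Cod D h) \<cdot>\<^bsub>D\<^esub> h \<cdot>\<^bsub>D\<^esub> p (Dom D h)))\<rparr>"
  have oG: "omap G Z = P Z" for Z by (simp add: G_def)
  have aG: "arr C (amap G h)" "Dom C (amap G h) = P (Dom D h)" "Cod C (amap G h) = P (Cod D h)"
    "amap F (amap G h) = p' (Cod D h) \<cdot>\<^bsub>D\<^esub> h \<cdot>\<^bsub>D\<^esub> p (Dom D h)" if "arr D h" for h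
  proof -
    have "p' (Cod D h) \<cdot>\<^bsub>D\<^esub> h \<cdot>\<^bsub>D\<^esub> p (Dom D h) \<in> Hom D (omap F (P (Dom D h))) (omap F (P (Cod D h)))"
      using that by (simp add: F.cod.hom_iff p_simps)
    note hom_lift[OF ff _ _ this]
    then show "arr C (amap G h)" "Dom C (amap G h) = P (Dom D h)" "Cod C (amap G h) = P (Cod D h)"
      "amap F (amap G h) = p' (Cod D h) \<cdot>\<^bsub>D\<^esub> h \<cdot>\<^bsub>D\<^esub> p (Dom D h)"
      using that by (simp_all add: F.dom.hom_iff G_def p_simps)
  qed
  have G: "is_functor D C G"
  proof
    fix f g X Y Z assume f: "f \<in> Hom D X Y" and g: "g \<in> Hom D Y Z"
    have Y: "Y \<in> Obj D" using F.cod.hom_obj[OF f] by simp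
    show "amap G (g \<cdot>\<^bsub>D\<^esub> f) = amap G g \<cdot>\<^bsub>C\<^esub> amap G f"
      by (rule eqI) (use f g Y F.cod.comp_tail[OF pp'[OF Y]] in \<open>auto simp: F.cod.hom_iff p_simps aG oG\<close>)
  next
    fix X assume "X \<in> Obj D"
    then show "amap G (\<one>\<^bsub>D\<^esub> X) = \<one>\<^bsub>C\<^esub> (omap G X)"
      by (intro eqI) (auto simp: F.cod.hom_iff p_simps aG oG)
  qed (auto simp: F.cod.hom_iff F.dom.hom_iff p_simps aG oG)
  interpret G: is_functor D C G by fact
  define s where "s X = hom_lift C F X (P (omap F X)) (p' (omap F X))" for X
  have s: "arr C (s X)" "Dom C (s X) = X" "Cod C (s X) = P (omap F X)"
    "amap F (s X) = p' (omap F X)" if "X \<in> Obj C" for X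
    using hom_lift[OF ff, of X "P (omap F X)" "p' (omap F X)"] that
    by (simp_all add: s_def p_simps F.dom.hom_iff F.cod.hom_iff)
  have s_iso: "is_iso C X (P (omap F X)) (s X)" if X: "X \<in> Obj C" for X
  proof -
    obtain q where q: "q \<in> Hom C (P (omap F X)) X" "amap F q = p (omap F X)"
      using fully_faithful_full[OF ff, of "P (omap F X)" X "p (omap F X)"] X
      by (auto simp: p_simps F.cod.hom_iff)
    have "q \<cdot>\<^bsub>C\<^esub> s X = \<one>\<^bsub>C\<^esub> X" "s X \<cdot>\<^bsub>C\<^esub> q = \<one>\<^bsub>C\<^esub> (P (omap F X))"
      by (rule eqI; use X q in \<open>simp add: F.dom.hom_iff s p_simps\<close>)+
    with q X show ?thesis unfolding is_iso_def by (auto simp: F.dom.hom_iff s)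
  qed
  have s_nat: "s Y \<cdot>\<^bsub>C\<^esub> f = amap G (amap F f) \<cdot>\<^bsub>C\<^esub> s X" if "f \<in> Hom C X Y" for f X Y
    by (rule eqI) (use that in \<open>auto simp: F.dom.hom_iff s aG oG p_simps\<close>)
  have t_nat: "p Y \<cdot>\<^bsub>D\<^esub> amap F (amap G f) = f \<cdot>\<^bsub>D\<^esub> p X" if "f \<in> Hom D X Y" for f X Y
  proof -
    have "Y \<in> Obj D" using F.cod.hom_obj[OF that] by simp
    then show ?thesis using that F.cod.comp_tail[OF pp', of Y "f \<cdot>\<^bsub>D\<^esub> p X"]
      by (auto simp: F.cod.hom_iff aG oG p_simps)
  qed
  have "nat_iso C C id_func (G \<circ>\<^sub>F F) s"
    using s_nat s_iso is_functor_id[OF F.dom.category_axioms] is_functor_comp[OF F G]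
    by (auto simp: nat_iso_def nat_trans_def nat_trans_axioms_def F.dom.hom_iff s p_simps oG)
  moreover have "nat_iso D D (F \<circ>\<^sub>F G) id_func p"
    using t_nat P pp' p'p is_functor_id[OF F.cod.category_axioms] is_functor_comp[OF G F]
    by (auto simp: nat_iso_def nat_trans_def nat_trans_axioms_def is_iso_def oG intro!: bexI[OF _ P(3)])
  ultimately show ?thesis
    unfolding equivalence_def using F G by blast
qed

section \<open>Idempotent completion\<close>

lemma Obj_idem_completion: "Obj (idem_completion C) = idempotents C"
  by (simp add: idem_completion_def)

lemma Ident_idem_completion: "\<one>\<^bsub>idem_completion C\<^esub> (X, e) = ((X, e), e, (X, e))"
  by (simp add: idem_completion_def)

lemma Comp_idem_completion:
  "(S', g, T) \<cdot>\<^bsub>idem_completion C\<^esub> (S, f, T') = (S, g \<cdot>\<^bsub>C\<^esub> f, T)"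
  by (simp add: idem_completion_def tagged_comp_def)

context category
begin

lemma idempotents_iff:
  "(X, e) \<in> idempotents C \<longleftrightarrow>
    X \<in> Obj C \<and> arr C e \<and> Dom C e = X \<and> Cod C e = X \<and> e \<cdot> e = e"
  by (auto simp: idempotents_def hom_iff)

text \<open>
  The condition \<open>f = d \<cdot> f \<cdot> e\<close> is split into absorption on either side, which is the form
  that can be used for rewriting.
\<close>

lemma Hom_idem_completion:
  "x \<in> Hom (idem_completion C) S T \<longleftrightarrow>
    (\<exists>f. x = (S, f, T) \<and> S \<in> idempotents C \<and> T \<in> idempotents C \<and>
      arr C f \<and> Dom C f = fst S \<and> Cod C f = fst T \<and> snd T \<cdot> f = f \<and> f \<cdot> snd S = f)"
proof -
  have "f = d \<cdot> f \<cdot> e \<longleftrightarrow> d \<cdot> f = f \<and> f \<cdot> e = f"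
    if "(X, e) \<in> idempotents C" "(Y, d) \<in> idempotents C" "f \<in> Hom C X Y" for X e Y d f
  proof
    assume *: "f = d \<cdot> f \<cdot> e"
    have "d \<cdot> d \<cdot> f \<cdot> e = d \<cdot> f \<cdot> e"
      using that comp_tail[of d d d "f \<cdot> e"] by (simp add: idempotents_iff hom_iff)
    moreover have "(d \<cdot> f \<cdot> e) \<cdot> e = d \<cdot> f \<cdot> e"
      using that by (simp add: idempotents_iff hom_iff)
    ultimately show "d \<cdot> f = f \<and> f \<cdot> e = f"
      using * by metis
  qed simp
  then show ?thesis
    by (cases S; cases T) (auto simp: idem_completion_def hom_iff)
qed

lemma category_idem_completion: "category (idem_completion C)"
proof
  fix f g h W X Y Z
  assume f: "f \<in> Hom (idem_completion C) W X" and g: "g \<in> Hom (idem_completion C) X Y"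
    and h: "h \<in> Hom (idem_completion C) Y Z"
  then show "(h \<cdot>\<^bsub>idem_completion C\<^esub> g) \<cdot>\<^bsub>idem_completion C\<^esub> f =
      h \<cdot>\<^bsub>idem_completion C\<^esub> g \<cdot>\<^bsub>idem_completion C\<^esub> f"
    by (auto simp: Hom_idem_completion Comp_idem_completion)
next
  fix f g X Y Z
  assume f: "f \<in> Hom (idem_completion C) X Y" and g: "g \<in> Hom (idem_completion C) Y Z"
  then show "g \<cdot>\<^bsub>idem_completion C\<^esub> f \<in> Hom (idem_completion C) X Z"
    using comp_tail[of "snd Z"]
    by (cases X; cases Z) (auto simp: Hom_idem_completion Comp_idem_completion idempotents_iff)
qed (auto simp: Hom_idem_completion Comp_idem_completion Obj_idem_completion
       Ident_idem_completion idempotents_iff)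

end

lemma amap_idem_func: "amap (idem_func F) (S, f, T) = (omap (idem_func F) S, amap F f, omap (idem_func F) T)"
  by (simp add: idem_func_def Let_def)

lemma omap_idem_func: "omap (idem_func F) (X, e) = (omap F X, amap F e)"
  by (simp add: idem_func_def Let_def)


lemma is_functor_idem_func:
  assumes "is_functor C D F"
  shows "is_functor (idem_completion C) (idem_completion D) (idem_func F)"
proof -
  interpret F: is_functor C D F by fact
  have obj: "omap (idem_func F) S \<in> idempotents D" if "S \<in> idempotents C" for S
    using that F.amap_comp_arr[of "snd S" "snd S"]
    by (cases S) (auto simp: omap_idem_func F.dom.idempotents_iff F.cod.idempotents_iff)
  interpret C': category "idem_completion C" by (rule F.dom.category_idem_completion)
  interpret D': category "idem_completion D" by (rule F.cod.category_idem_completion)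
  show ?thesis
  proof
    fix x S T assume "x \<in> Hom (idem_completion C) S T"
    then obtain f where f: "x = (S, f, T)" "S \<in> idempotents C" "T \<in> idempotents C"
      "arr C f" "Dom C f = fst S" "Cod C f = fst T" "snd T \<cdot>\<^bsub>C\<^esub> f = f" "f \<cdot>\<^bsub>C\<^esub> snd S = f"
      by (auto simp: F.dom.Hom_idem_completion)
    then show "amap (idem_func F) x \<in> Hom (idem_completion D) (omap (idem_func F) S) (omap (idem_func F) T)"
      using obj F.amap_comp_arr[of f "snd T"] F.amap_comp_arr[of "snd S" f]
      by (cases S; cases T)
         (auto simp: F.cod.Hom_idem_completion amap_idem_func omap_idem_func F.dom.idempotents_iff)
  next
    fix x y S T U
    assume "x \<in> Hom (idem_completion C) S T" "y \<in> Hom (idem_completion C) T U"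
    then show "amap (idem_func F) (y \<cdot>\<^bsub>idem_completion C\<^esub> x) =
        amap (idem_func F) y \<cdot>\<^bsub>idem_completion D\<^esub> amap (idem_func F) x"
      by (auto simp: F.dom.Hom_idem_completion amap_idem_func Comp_idem_completion)
  qed (auto simp: Obj_idem_completion obj Ident_idem_completion amap_idem_func omap_idem_func)
qed

text \<open>
  The category \<open>C\<close> sits fully in its completion as the objects \<open>(X, 1)\<close>, which gives one direction.
  For the other, faithfulness lifts the absorption equations from a morphism to its preimage.
\<close>

lemma fully_faithful_idem_func_iff:
  assumes F: "is_functor C D F"
  shows "fully_faithful (idem_completion C) (idem_completion D) (idem_func F) \<longleftrightarrow> fully_faithful C D F"
proof
  interpret F: is_functor C D F by fact
  have id_idem: "(X, \<one>\<^bsub>C\<^esub> X) \<in> idempotents C" if "X \<in> Obj C" for X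
    using that by (simp add: F.dom.idempotents_iff)
  {
    assume ff: "fully_faithful (idem_completion C) (idem_completion D) (idem_func F)"
    show "fully_faithful C D F"
    proof (rule fully_faithfulI[OF F])
      fix X Y f g
      assume f: "f \<in> Hom C X Y" and g: "g \<in> Hom C X Y" and eq: "amap F f = amap F g"
      let ?S = "(X, \<one>\<^bsub>C\<^esub> X)" and ?T = "(Y, \<one>\<^bsub>C\<^esub> Y)"
      have "X \<in> Obj C" "Y \<in> Obj C" using F.dom.hom_obj[OF f] by auto
      then have "(?S, f, ?T) \<in> Hom (idem_completion C) ?S ?T"
        "(?S, g, ?T) \<in> Hom (idem_completion C) ?S ?T"
        using f g by (auto simp: F.dom.Hom_idem_completion id_idem F.dom.hom_iff)
      from fully_faithful_faithful[OF ff F.dom.category_idem_completion this]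
      show "f = g" using eq by (simp add: amap_idem_func)
    next
      fix X Y h
      assume X: "X \<in> Obj C" and Y: "Y \<in> Obj C" and h: "h \<in> Hom D (omap F X) (omap F Y)"
      let ?S = "(X, \<one>\<^bsub>C\<^esub> X)" and ?T = "(Y, \<one>\<^bsub>C\<^esub> Y)"
      have "(omap (idem_func F) ?S, h, omap (idem_func F) ?T)
          \<in> Hom (idem_completion D) (omap (idem_func F) ?S) (omap (idem_func F) ?T)"
        using X Y h by (auto simp: F.cod.Hom_idem_completion omap_idem_func F.cod.idempotents_iff F.cod.hom_iff)
      then obtain x where x: "x \<in> Hom (idem_completion C) ?S ?T"
        "amap (idem_func F) x = (omap (idem_func F) ?S, h, omap (idem_func F) ?T)"
        using fully_faithful_full[OF ff] id_idem[OF X] id_idem[OF Y]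
        by (metis Obj_idem_completion)
      then show "\<exists>f \<in> Hom C X Y. amap F f = h"
        by (auto simp: F.dom.Hom_idem_completion amap_idem_func F.dom.hom_iff)
    qed
  }
  assume ff: "fully_faithful C D F"
  have eqI: "f = g" if "arr C f" "arr C g" "Dom C f = Dom C g" "Cod C f = Cod C g"
    "amap F f = amap F g" for f g
    using fully_faithful_faithful[OF ff F.dom.category_axioms] that F.dom.hom_iff by metis
  show "fully_faithful (idem_completion C) (idem_completion D) (idem_func F)"
  proof (rule fully_faithfulI[OF is_functor_idem_func[OF F]])
    fix S T x y
    assume "x \<in> Hom (idem_completion C) S T" "y \<in> Hom (idem_completion C) S T"
      "amap (idem_func F) x = amap (idem_func F) y"
    then show "x = y" by (auto simp: F.dom.Hom_idem_completion amap_idem_func intro: eqI)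
  next
    fix S T z
    assume S: "S \<in> Obj (idem_completion C)" and T: "T \<in> Obj (idem_completion C)"
      and z: "z \<in> Hom (idem_completion D) (omap (idem_func F) S) (omap (idem_func F) T)"
    obtain X e Y d where ST: "S = (X, e)" "T = (Y, d)" by (cases S, cases T)
    from z obtain h where h: "z = (omap (idem_func F) S, h, omap (idem_func F) T)"
      "arr D h" "Dom D h = omap F X" "Cod D h = omap F Y"
      "amap F d \<cdot>\<^bsub>D\<^esub> h = h" "h \<cdot>\<^bsub>D\<^esub> amap F e = h"
      by (auto simp: F.cod.Hom_idem_completion ST omap_idem_func)
    obtain f where f: "f \<in> Hom C X Y" "amap F f = h"
      using fully_faithful_full[OF ff, of X Y h] S T h ST
      by (auto simp: Obj_idem_completion F.dom.idempotents_iff F.cod.hom_iff)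
    have "d \<cdot>\<^bsub>C\<^esub> f = f" "f \<cdot>\<^bsub>C\<^esub> e = f"
      by (rule eqI; use S T f h ST in \<open>simp add: Obj_idem_completion F.dom.idempotents_iff F.dom.hom_iff\<close>)+
    then have "(S, f, T) \<in> Hom (idem_completion C) S T"
      using S T f ST by (simp add: F.dom.Hom_idem_completion F.dom.hom_iff Obj_idem_completion)
    then show "\<exists>x \<in> Hom (idem_completion C) S T. amap (idem_func F) x = z"
      using h(1) f(2) by (metis amap_idem_func)
  qed
qed

definition is_retract :: "('o, 'm) cat \<Rightarrow> 'o \<Rightarrow> 'o \<Rightarrow> bool" where
  "is_retract C X Y \<longleftrightarrow> (\<exists>s \<in> Hom C X Y. \<exists>r \<in> Hom C Y X. r \<cdot>\<^bsub>C\<^esub> s = \<one>\<^bsub>C\<^esub> X)"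

text \<open>
  For essential surjectivity, let \<open>(N, e)\<close> be given with \<open>s : N \<rightarrow> F X\<close> and \<open>r \<cdot> s = 1\<close>. The
  endomorphism \<open>s \<cdot> e \<cdot> r\<close> of \<open>F X\<close> is idempotent, hence \<open>F q\<close> for an idempotent \<open>q\<close>, and
  \<open>(F X, F q)\<close> is isomorphic to \<open>(N, e)\<close> through \<open>e \<cdot> r\<close> and \<open>s \<cdot> e\<close>.
\<close>

lemma equivalence_up_to_retractsI:
  assumes F: "is_functor C D F" and ff: "fully_faithful C D F"
    and retract: "\<And>N. N \<in> Obj D \<Longrightarrow> \<exists>X \<in> Obj C. is_retract D N (omap F X)"
  shows "equivalence_up_to_retracts C D F"
proof -
  interpret F: is_functor C D F by fact
  have "equivalence (idem_completion C) (idem_completion D) (idem_func F)"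
  proof (rule fully_faithful_imp_equivalence)
    fix T assume T: "T \<in> Obj (idem_completion D)"
    obtain N e where Ne: "T = (N, e)" by (cases T)
    have e: "N \<in> Obj D" "arr D e" "Dom D e = N" "Cod D e = N" "e \<cdot>\<^bsub>D\<^esub> e = e"
      using T by (simp_all add: Ne Obj_idem_completion F.cod.idempotents_iff)
    obtain X s r where X: "X \<in> Obj C"
      and s: "arr D s" "Dom D s = N" "Cod D s = omap F X"
      and r: "arr D r" "Dom D r = omap F X" "Cod D r = N" and rs: "r \<cdot>\<^bsub>D\<^esub> s = \<one>\<^bsub>D\<^esub> N"
      using retract[OF e(1)] unfolding is_retract_def by (auto simp: F.cod.hom_iff)
    note [simp] = e s r rs F.cod.comp_tail[OF rs] F.cod.comp_tail[OF e(5)]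
    obtain q where q: "q \<in> Hom C X X" and Fq: "amap F q = s \<cdot>\<^bsub>D\<^esub> e \<cdot>\<^bsub>D\<^esub> r"
      using fully_faithful_full[OF ff X X, of "s \<cdot>\<^bsub>D\<^esub> e \<cdot>\<^bsub>D\<^esub> r"] by (auto simp: F.cod.hom_iff)
    have "amap F (q \<cdot>\<^bsub>C\<^esub> q) = amap F q"
      using q by (simp add: F.dom.hom_iff Fq)
    then have "q \<cdot>\<^bsub>C\<^esub> q = q"
      using fully_faithful_faithful[OF ff F.dom.category_axioms F.dom.comp_hom[OF q q] q] by blast
    then have Xq: "(X, q) \<in> Obj (idem_completion C)"
      using X q by (simp add: Obj_idem_completion F.dom.idempotents_iff F.dom.hom_iff)
    let ?S = "omap (idem_func F) (X, q)"
    have S: "?S \<in> idempotents D"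
      using is_functor.omap_obj[OF is_functor_idem_func[OF F] Xq] by (simp add: Obj_idem_completion)
    have T': "T \<in> idempotents D" using T by (simp add: Obj_idem_completion)
    have "is_iso (idem_completion D) ?S T (?S, e \<cdot>\<^bsub>D\<^esub> r, T)"
      unfolding is_iso_def
    proof (intro conjI bexI)
      show "(?S, e \<cdot>\<^bsub>D\<^esub> r, T) \<in> Hom (idem_completion D) ?S T"
        "(T, s \<cdot>\<^bsub>D\<^esub> e, ?S) \<in> Hom (idem_completion D) T ?S"
        using S T' by (auto simp: F.cod.Hom_idem_completion Ne omap_idem_func Fq)
    qed (auto simp: Comp_idem_completion Ident_idem_completion omap_idem_func Ne Fq)
    with Xq show "\<exists>S \<in> Obj (idem_completion C). \<exists>p. is_iso (idem_completion D) (omap (idem_func F) S) T p"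
      by blast
  qed (use F ff in \<open>simp_all add: is_functor_idem_func fully_faithful_idem_func_iff\<close>)
  then show ?thesis using F by (simp add: equivalence_up_to_retracts_def)
qed

lemma equivalence_up_to_retracts_imp_fully_faithful:
  "equivalence_up_to_retracts C D F \<Longrightarrow> fully_faithful C D F"
  unfolding equivalence_up_to_retracts_def
  using equivalence_imp_fully_faithful fully_faithful_idem_func_iff by blast



section \<open>Modules over a separable monad\<close>

lemma Obj_Mod: "Obj (Mod C M) = modules C M"
  by (simp add: Mod_def)

lemma Ident_Mod: "\<one>\<^bsub>Mod C M\<^esub> (X, l) = ((X, l), \<one>\<^bsub>C\<^esub> X, (X, l))"
  by (simp add: Mod_def)

lemma Comp_Mod: "(S', g, T) \<cdot>\<^bsub>Mod C M\<^esub> (S, f, T') = (S, g \<cdot>\<^bsub>C\<^esub> f, T)"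
  by (simp add: Mod_def tagged_comp_def)

context is_monad
begin

sublocale unit: nat_trans C C id_func "endo M" "unit M" by (rule unit_nat)
sublocale mult: nat_trans C C "endo M \<circ>\<^sub>F endo M" "endo M" "mult M" by (rule mult_nat)

lemma modules_iff:
  "(X, l) \<in> modules C M \<longleftrightarrow> X \<in> Obj C \<and> arr C l \<and> Dom C l = omap (endo M) X \<and> Cod C l = X \<and>
    l \<cdot> amap (endo M) l = l \<cdot> mult M X \<and> l \<cdot> unit M X = \<one> X"
  by (auto simp: modules_def hom_iff)

lemma Hom_Mod:
  "x \<in> Hom (Mod C M) S T \<longleftrightarrow> (\<exists>f. x = (S, f, T) \<and> S \<in> modules C M \<and> T \<in> modules C M \<and>
    arr C f \<and> Dom C f = fst S \<and> Cod C f = fst T \<and> f \<cdot> snd S = snd T \<cdot> amap (endo M) f)"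
  by (cases S; cases T) (auto simp: Mod_def hom_iff)

lemma category_Mod: "category (Mod C M)"
proof
  fix x y R S T
  assume "x \<in> Hom (Mod C M) R S" and "y \<in> Hom (Mod C M) S T"
  then obtain f g where x: "x = (R, f, S)" and y: "y = (S, g, T)"
    and R: "R \<in> modules C M" and S: "S \<in> modules C M" and T: "T \<in> modules C M"
    and f: "arr C f" "Dom C f = fst R" "Cod C f = fst S" "f \<cdot> snd R = snd S \<cdot> amap (endo M) f"
    and g: "arr C g" "Dom C g = fst S" "Cod C g = fst T" "g \<cdot> snd S = snd T \<cdot> amap (endo M) g"
    by (auto simp: Hom_Mod)
  have "(g \<cdot> f) \<cdot> snd R = snd T \<cdot> amap (endo M) (g \<cdot> f)"
    using R S T f g comp_tail[OF g(4), of "amap (endo M) f"]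
    by (cases R; cases S; cases T) (simp add: modules_iff)
  then show "y \<cdot>\<^bsub>Mod C M\<^esub> x \<in> Hom (Mod C M) R T"
    using R T f g by (simp add: x y Comp_Mod Hom_Mod)
qed (auto simp: Hom_Mod Comp_Mod Obj_Mod Ident_Mod modules_iff)

lemma free_module: "X \<in> Obj C \<Longrightarrow> (omap (endo M) X, mult M X) \<in> modules C M"
  using mult_assoc mult_unit_endo by (simp add: modules_iff)

end

locale split_monad = is_monad C M + split: nat_trans C C "endo M" "endo M \<circ>\<^sub>F endo M" \<sigma>
  for C :: "('o, 'm) cat" (structure) and M :: "('o, 'm) monad" and \<sigma> :: "'o \<Rightarrow> 'm" +
  assumes mult_split: "X \<in> Obj C \<Longrightarrow> mult M X \<cdot> \<sigma> X = \<one> (omap (endo M) X)"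
    and split_mult: "X \<in> Obj C \<Longrightarrow>
      amap (endo M) (mult M X) \<cdot> \<sigma> (omap (endo M) X) = \<sigma> X \<cdot> mult M X"
    and split_mult': "X \<in> Obj C \<Longrightarrow>
      mult M (omap (endo M) X) \<cdot> amap (endo M) (\<sigma> X) = \<sigma> X \<cdot> mult M X"

lemma separable_monad_iff: "separable_monad C M \<longleftrightarrow> (\<exists>\<sigma>. split_monad C M \<sigma>)"
  unfolding separable_monad_def split_monad_def split_monad_axioms_def by metis

context split_monad
begin

text \<open>
  The unit \<open>\<eta>\<^sub>X : X \<rightarrow> M X\<close> is a section of the action in the base category, but usually not a module
  morphism. Averaging it over \<open>\<sigma>\<close> makes it one.
\<close>

definition module_section :: "'o \<times> 'm \<Rightarrow> 'm" where
  "module_section = (\<lambda>(X, l). amap (endo M) l \<cdot> \<sigma> X \<cdot> unit M X)"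

lemma arr_module_section [simp]:
  assumes "(X, l) \<in> modules C M"
  shows "arr C (module_section (X, l))" "Dom C (module_section (X, l)) = X"
    "Cod C (module_section (X, l)) = omap (endo M) X"
  using assms by (simp_all add: module_section_def modules_iff)

lemma module_section_split:
  assumes "(X, l) \<in> modules C M"
  shows "l \<cdot> module_section (X, l) = \<one> X"
proof -
  have l: "X \<in> Obj C" "arr C l" "Dom C l = omap (endo M) X" "Cod C l = X"
    "l \<cdot> amap (endo M) l = l \<cdot> mult M X" "l \<cdot> unit M X = \<one> X"
    using assms by (simp_all add: modules_iff)
  have "l \<cdot> module_section (X, l) = l \<cdot> mult M X \<cdot> \<sigma> X \<cdot> unit M X"
    using l comp_tail[OF l(5)] by (simp add: module_section_def)
  also have "\<dots> = l \<cdot> unit M X"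
    using l comp_tail[OF mult_split[OF l(1)]] by simp
  finally show ?thesis using l by simp
qed

text \<open>
  Both sides reduce to \<open>M l \<cdot> \<sigma>\<^sub>X\<close>: the left one by moving \<open>l\<close> through \<open>\<eta>\<close> and \<open>\<sigma>\<close> and using that
  \<open>\<sigma>\<close> commutes with \<open>\<mu>\<close> on one side, the right one by the equation on the other side.
\<close>

lemma module_section_linear:
  assumes "(X, l) \<in> modules C M"
  shows "module_section (X, l) \<cdot> l = mult M X \<cdot> amap (endo M) (module_section (X, l))"
proof -
  let ?T = "omap (endo M)" and ?M = "amap (endo M)"
  have l: "X \<in> Obj C" "arr C l" "Dom C l = ?T X" "Cod C l = X"
    "l \<cdot> ?M l = l \<cdot> mult M X" "l \<cdot> unit M X = \<one> X"
    using assms by (simp_all add: modules_iff)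
  have MM: "?M l \<cdot> ?M (?M l) = ?M l \<cdot> ?M (mult M X)"
    using arg_cong[OF l(5), of ?M] l(1-4) by simp
  have unit_l: "unit M X \<cdot> l = ?M l \<cdot> unit M (?T X)"
    using unit.naturality_arr[OF l(2)] l by simp
  have split_l: "\<sigma> X \<cdot> ?M l = ?M (?M l) \<cdot> \<sigma> (?T X)"
    using split.naturality_arr[OF l(2)] l by simp
  have mult_l: "mult M X \<cdot> ?M (?M l) = ?M l \<cdot> mult M (?T X)"
    using mult.naturality_arr[OF l(2)] l by simp
  have "module_section (X, l) \<cdot> l = ?M l \<cdot> \<sigma> X \<cdot> ?M l \<cdot> unit M (?T X)"
    using l by (simp add: module_section_def unit_l)
  also have "\<dots> = ?M l \<cdot> ?M (?M l) \<cdot> \<sigma> (?T X) \<cdot> unit M (?T X)"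
    using l comp_tail[OF split_l] by simp
  also have "\<dots> = ?M l \<cdot> ?M (mult M X) \<cdot> \<sigma> (?T X) \<cdot> unit M (?T X)"
    using l comp_tail[OF MM] by simp
  also have "\<dots> = ?M l \<cdot> \<sigma> X \<cdot> mult M X \<cdot> unit M (?T X)"
    using l comp_tail[OF split_mult[OF l(1)]] by simp
  \<comment> \<open>Both unit laws give the identity; exchanging them switches sides.\<close>
  also have "\<dots> = ?M l \<cdot> \<sigma> X \<cdot> mult M X \<cdot> ?M (unit M X)"
    using l by (simp add: mult_unit_endo mult_endo_unit)
  also have "\<dots> = ?M l \<cdot> mult M (?T X) \<cdot> ?M (\<sigma> X) \<cdot> ?M (unit M X)"
    using l comp_tail[OF split_mult'[OF l(1)]] by simp
  also have "\<dots> = mult M X \<cdot> ?M (module_section (X, l))"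
    using l comp_tail[OF mult_l] by (simp add: module_section_def)
  finally show ?thesis .
qed

lemma module_section_natural:
  assumes "(S, a, T) \<in> Hom (Mod C M) S T"
  shows "module_section T \<cdot> a = amap (endo M) a \<cdot> module_section S"
proof -
  let ?T = "omap (endo M)" and ?M = "amap (endo M)"
  obtain X l Y k where ST: "S = (X, l)" "T = (Y, k)" by (cases S, cases T)
  have h: "X \<in> Obj C" "arr C l" "Dom C l = ?T X" "Cod C l = X"
    "Y \<in> Obj C" "arr C k" "Dom C k = ?T Y" "Cod C k = Y"
    "arr C a" "Dom C a = X" "Cod C a = Y" "a \<cdot> l = k \<cdot> ?M a"
    using assms by (simp_all add: ST Hom_Mod modules_iff)
  have unit_a: "unit M Y \<cdot> a = ?M a \<cdot> unit M X"
    using unit.naturality_arr[OF h(9)] h by simp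
  have split_a: "\<sigma> Y \<cdot> ?M a = ?M (?M a) \<cdot> \<sigma> X"
    using split.naturality_arr[OF h(9)] h by simp
  have M_a: "?M k \<cdot> ?M (?M a) = ?M a \<cdot> ?M l"
    using arg_cong[OF h(12), of ?M] h(1-11) by simp
  show ?thesis
    using h comp_tail[OF split_a] comp_tail[OF M_a] by (simp add: ST module_section_def unit_a)
qed

lemma module_retract_of_free:
  assumes N: "(X, l) \<in> modules C M"
  shows "is_retract (Mod C M) (X, l) (omap (endo M) X, mult M X)"
  unfolding is_retract_def
proof (intro bexI)
  let ?N = "(X, l)" and ?FX = "(omap (endo M) X, mult M X)"
  have X: "X \<in> Obj C" using N by (simp add: modules_iff)
  show "(?N, module_section ?N, ?FX) \<in> Hom (Mod C M) ?N ?FX"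
    using N X by (simp add: Hom_Mod free_module module_section_linear)
  show "(?FX, l, ?N) \<in> Hom (Mod C M) ?FX ?N"
    using N X free_module[OF X] by (simp add: Hom_Mod modules_iff)
  show "(?FX, l, ?N) \<cdot>\<^bsub>Mod C M\<^esub> (?N, module_section ?N, ?FX) = \<one>\<^bsub>Mod C M\<^esub> ?N"
    using N by (simp add: Comp_Mod Ident_Mod module_section_split)
qed

text \<open>
  The retraction that makes the forgetful functor from modules separable: \<open>h\<close> is extended to the free
  modules, where every \<open>M h\<close> is linear, and then pulled back along the section of the source and pushed
  forward along the action of the target.
\<close>

definition linearize :: "'o \<times> 'm \<Rightarrow> 'o \<times> 'm \<Rightarrow> 'm \<Rightarrow> 'm" where
  "linearize S T h = snd T \<cdot> amap (endo M) h \<cdot> module_section S"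

lemma linearize_hom:
  assumes S: "S \<in> modules C M" and T: "T \<in> modules C M" and h: "h \<in> Hom C (fst S) (fst T)"
  shows "(S, linearize S T h, T) \<in> Hom (Mod C M) S T"
proof -
  let ?T = "omap (endo M)" and ?M = "amap (endo M)"
  obtain X l Y k where ST: "S = (X, l)" "T = (Y, k)" by (cases S, cases T)
  let ?s = "module_section (X, l)"
  note N = S[unfolded ST]
  have h: "X \<in> Obj C" "arr C l" "Dom C l = ?T X" "Cod C l = X"
    "Y \<in> Obj C" "arr C k" "Dom C k = ?T Y" "Cod C k = Y"
    "arr C h" "Dom C h = X" "Cod C h = Y" "k \<cdot> ?M k = k \<cdot> mult M Y"
    using S T h by (simp_all add: ST modules_iff hom_iff)
  note [simp] = h(1-11) arr_module_section[OF N]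
  have mult_h: "mult M Y \<cdot> ?M (?M h) = ?M h \<cdot> mult M X"
    using mult.naturality_arr[OF h(9)] by simp
  have "linearize S T h \<cdot> l = k \<cdot> ?M h \<cdot> mult M X \<cdot> ?M ?s"
    by (simp add: linearize_def ST module_section_linear[OF N])
  also have "\<dots> = k \<cdot> mult M Y \<cdot> ?M (?M h) \<cdot> ?M ?s"
    using comp_tail[OF mult_h] by simp
  also have "\<dots> = k \<cdot> ?M (linearize S T h)"
    using comp_tail[OF h(12)] by (simp add: linearize_def ST)
  finally show ?thesis
    using S T by (simp add: Hom_Mod ST) (simp add: linearize_def)
qed

lemma linearize_natural_source:
  assumes a: "(R, a, S) \<in> Hom (Mod C M) R S" and T: "T \<in> modules C M"
    and h: "h \<in> Hom C (fst S) (fst T)"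
  shows "linearize R T (h \<cdot> a) = linearize S T h \<cdot> a"
proof -
  have "R \<in> modules C M" "S \<in> modules C M" using a by (auto simp: Hom_Mod)
  then show ?thesis
    using a T h module_section_natural[OF a]
    by (cases R; cases S; cases T) (simp add: Hom_Mod hom_iff modules_iff linearize_def)
qed

lemma linearize_natural_target:
  assumes S: "S \<in> modules C M" and b: "(T, b, U) \<in> Hom (Mod C M) T U"
    and h: "h \<in> Hom C (fst S) (fst T)"
  shows "linearize S U (b \<cdot> h) = b \<cdot> linearize S T h"
proof -
  have "b \<cdot> snd T = snd U \<cdot> amap (endo M) b" "T \<in> modules C M" "U \<in> modules C M"
    using b by (auto simp: Hom_Mod)
  then show ?thesis
    using S b h comp_tail[of b "snd T" _ "amap (endo M) h \<cdot> module_section S"]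
    by (cases S; cases T; cases U) (simp add: Hom_Mod hom_iff modules_iff linearize_def)
qed

lemma linearize_linear:
  assumes "(S, f, T) \<in> Hom (Mod C M) S T"
  shows "linearize S T f = f"
proof -
  have "f \<cdot> snd S = snd T \<cdot> amap (endo M) f" "S \<in> modules C M" "T \<in> modules C M"
    using assms by (auto simp: Hom_Mod)
  then show ?thesis
    using assms comp_tail[of f "snd S" _ "module_section S"] module_section_split[of "fst S" "snd S"]
    by (cases S; cases T) (simp add: Hom_Mod hom_iff modules_iff linearize_def)
qed

end


section \<open>The comparison functor\<close>

context adjunction
begin

abbreviation "M \<equiv> adjunction_monad F G \<eta> \<epsilon>"
abbreviation "K \<equiv> comparison D G \<epsilon>"

lemma adjunction_monad_simps [simp]:
  "endo M = G \<circ>\<^sub>F F" "unit M = \<eta>" "mult M X = amap G (\<epsilon> (omap F X))"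
  by (simp_all add: adjunction_monad_def)

sublocale F: is_functor C D F by (rule left_functor)
sublocale G: is_functor D C G by (rule right_functor)
sublocale unit: nat_trans C C id_func "G \<circ>\<^sub>F F" \<eta> by (rule unit_nat)
sublocale counit: nat_trans D D "F \<circ>\<^sub>F G" id_func \<epsilon> by (rule counit_nat)

lemma counit_counit:
  "Y \<in> Obj D \<Longrightarrow> \<epsilon> Y \<cdot>\<^bsub>D\<^esub> \<epsilon> (omap F (omap G Y)) = \<epsilon> Y \<cdot>\<^bsub>D\<^esub> amap F (amap G (\<epsilon> Y))"
  using counit.naturality_arr[of "\<epsilon> Y"] by simp

lemma is_monad: "is_monad C M"
proof (rule is_monad.intro[OF left.category_axioms is_monad_axioms.intro])
  show "nat_trans C C id_func (endo M) (unit M)" using unit_nat by simp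
  show "nat_trans C C (endo M \<circ>\<^sub>F endo M) (endo M) (mult M)"
  proof
    fix f X Y assume f: "f \<in> Hom C X Y"
    have "amap G (\<epsilon> (omap F Y) \<cdot>\<^bsub>D\<^esub> amap F (amap G (amap F f))) =
        amap G (amap F f \<cdot>\<^bsub>D\<^esub> \<epsilon> (omap F X))"
      using f counit.naturality_arr[of "amap F f"] by (simp add: left.hom_iff)
    then show "mult M Y \<cdot>\<^bsub>C\<^esub> amap (endo M \<circ>\<^sub>F endo M) f = amap (endo M) f \<cdot>\<^bsub>C\<^esub> mult M X"
      using f left.hom_obj[OF f] by (simp add: left.hom_iff)
  qed (auto simp: left.hom_iff)
next
  fix X assume X: "X \<in> Obj C"
  show "mult M X \<cdot>\<^bsub>C\<^esub> amap (endo M) (mult M X) = mult M X \<cdot>\<^bsub>C\<^esub> mult M (omap (endo M) X)"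
    using X arg_cong[OF counit_counit[of "omap F X"], of "amap G"] by simp
  show "mult M X \<cdot>\<^bsub>C\<^esub> amap (endo M) (unit M X) = \<one>\<^bsub>C\<^esub> (omap (endo M) X)"
    using X arg_cong[OF triangle_left[OF X], of "amap G"] by simp
  show "mult M X \<cdot>\<^bsub>C\<^esub> unit M (omap (endo M) X) = \<one>\<^bsub>C\<^esub> (omap (endo M) X)"
    using X triangle_right by simp
qed

sublocale monad: is_monad C M by (rule is_monad)

lemma omap_comparison [simp]: "omap K Y = (omap G Y, amap G (\<epsilon> Y))"
  by (simp add: comparison_def)

lemma amap_comparison:
  "f \<in> Hom D X Y \<Longrightarrow> amap K f = (omap K X, amap G f, omap K Y)"
  by (simp add: comparison_def right.hom_iff)

lemma comparison_module:
  assumes "Y \<in> Obj D"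
  shows "(omap G Y, amap G (\<epsilon> Y)) \<in> modules C M"
  using assms arg_cong[OF counit_counit[OF assms], of "amap G"]
  by (simp add: monad.modules_iff triangle_right)

lemma comparison_hom:
  assumes f: "f \<in> Hom D X Y"
  shows "(omap K X, amap G f, omap K Y) \<in> Hom (Mod C M) (omap K X) (omap K Y)"
  using f right.hom_obj[OF f] arg_cong[OF counit.naturality[OF f], of "amap G"]
  by (simp add: monad.Hom_Mod comparison_module right.hom_iff)

lemma is_functor_comparison: "is_functor D (Mod C M) K"
proof -
  interpret mod: category "Mod C M" by (rule monad.category_Mod)
  show ?thesis
  proof
    fix f g X Y Z assume f: "f \<in> Hom D X Y" and g: "g \<in> Hom D Y Z"
    show "amap K (g \<cdot>\<^bsub>D\<^esub> f) = amap K g \<cdot>\<^bsub>Mod C M\<^esub> amap K f"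
      using amap_comparison[OF f] amap_comparison[OF g] amap_comparison[OF right.comp_hom[OF f g]]
        G.amap_comp[OF f g] by (simp add: Comp_Mod)
  next
    fix X assume "X \<in> Obj D"
    then show "amap K (\<one>\<^bsub>D\<^esub> X) = \<one>\<^bsub>Mod C M\<^esub> (omap K X)"
      by (simp add: amap_comparison[OF right.id_hom] Ident_Mod)
  qed (use comparison_hom in \<open>auto simp: Obj_Mod comparison_module amap_comparison\<close>)
qed

end

locale split_counit = adjunction C D F G \<eta> \<epsilon> + splitting: nat_trans D D id_func "F \<circ>\<^sub>F G" \<xi>
  for C :: "('o1, 'm1) cat" and D :: "('o2, 'm2) cat" and F G \<eta> \<epsilon> and \<xi> :: "'o2 \<Rightarrow> 'm2" +
  assumes counit_section: "Y \<in> Obj D \<Longrightarrow> \<epsilon> Y \<cdot>\<^bsub>D\<^esub> \<xi> Y = \<one>\<^bsub>D\<^esub> Y"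
begin

text \<open>
  The three equations are the images under \<open>G\<close> of \<open>\<epsilon> \<cdot> \<xi> = 1\<close>, of naturality of \<open>\<xi>\<close> at a component of
  \<open>\<epsilon>\<close>, and of naturality of \<open>\<epsilon>\<close> at a component of \<open>\<xi>\<close>.
\<close>

lemma split_monad: "split_monad C M (\<lambda>X. amap G (\<xi> (omap F X)))"
proof (rule split_monad.intro[OF is_monad])
  show "nat_trans C C (endo M) (endo M \<circ>\<^sub>F endo M) (\<lambda>X. amap G (\<xi> (omap F X)))"
  proof
    fix f X Y assume f: "f \<in> Hom C X Y"
    show "amap G (\<xi> (omap F Y)) \<cdot>\<^bsub>C\<^esub> amap (endo M) f =
        amap (endo M \<circ>\<^sub>F endo M) f \<cdot>\<^bsub>C\<^esub> amap G (\<xi> (omap F X))"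
      using f left.hom_obj[OF f] arg_cong[OF splitting.naturality[OF F.amap_hom[OF f]], of "amap G"]
      by (simp add: left.hom_iff)
  qed (auto simp: left.hom_iff)
  show "split_monad_axioms C M (\<lambda>X. amap G (\<xi> (omap F X)))"
  proof
    fix X assume X: "X \<in> Obj C"
    let ?Y = "omap F X"
    show "mult M X \<cdot>\<^bsub>C\<^esub> amap G (\<xi> ?Y) = \<one>\<^bsub>C\<^esub> (omap (endo M) X)"
      using X arg_cong[OF counit_section[of ?Y], of "amap G"] by simp
    show "amap (endo M) (mult M X) \<cdot>\<^bsub>C\<^esub> amap G (\<xi> (omap F (omap (endo M) X))) =
        amap G (\<xi> ?Y) \<cdot>\<^bsub>C\<^esub> mult M X"
      using X arg_cong[OF splitting.naturality_arr[of "\<epsilon> ?Y"], of "amap G"] by simp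
    show "mult M (omap (endo M) X) \<cdot>\<^bsub>C\<^esub> amap (endo M) (amap G (\<xi> ?Y)) =
        amap G (\<xi> ?Y) \<cdot>\<^bsub>C\<^esub> mult M X"
      using X arg_cong[OF counit.naturality_arr[of "\<xi> ?Y"], of "amap G"] by simp
  qed
qed

lemma right_adjoint_recover:
  assumes f: "f \<in> Hom D X Y"
  shows "\<epsilon> Y \<cdot>\<^bsub>D\<^esub> amap F (amap G f) \<cdot>\<^bsub>D\<^esub> \<xi> X = f"
proof -
  have "\<epsilon> Y \<cdot>\<^bsub>D\<^esub> amap F (amap G f) = f \<cdot>\<^bsub>D\<^esub> \<epsilon> X"
    using counit.naturality[OF f] by simp
  then show ?thesis
    using f right.hom_obj[OF f] right.comp_tail[of "\<epsilon> Y" "amap F (amap G f)" _ "\<xi> X"] counit_section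
    by (simp add: right.hom_iff)
qed

text \<open>
  The formula \<open>\<epsilon>\<^sub>Y \<cdot> F h \<cdot> \<xi>\<^sub>X\<close> makes sense for every \<open>h : G X \<rightarrow> G Y\<close>. It recovers \<open>f\<close> from \<open>G f\<close>, and
  it yields a preimage of \<open>h\<close> under \<open>G\<close> as soon as \<open>h\<close> is a module morphism.
\<close>

lemma fully_faithful_comparison: "fully_faithful D (Mod C M) K"
proof (rule fully_faithfulI[OF is_functor_comparison])
  fix X Y f g
  assume f: "f \<in> Hom D X Y" and g: "g \<in> Hom D X Y" and "amap K f = amap K g"
  then have "amap G f = amap G g" by (simp add: amap_comparison)
  then show "f = g" using right_adjoint_recover[OF f] right_adjoint_recover[OF g] by metis
next
  fix X Y x
  assume X: "X \<in> Obj D" and Y: "Y \<in> Obj D" and x: "x \<in> Hom (Mod C M) (omap K X) (omap K Y)"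
  then obtain h where h: "x = (omap K X, h, omap K Y)" "arr C h" "Dom C h = omap G X" "Cod C h = omap G Y"
    "h \<cdot>\<^bsub>C\<^esub> amap G (\<epsilon> X) = amap G (\<epsilon> Y) \<cdot>\<^bsub>C\<^esub> amap G (amap F h)"
    by (auto simp: monad.Hom_Mod)
  define f where "f = \<epsilon> Y \<cdot>\<^bsub>D\<^esub> amap F h \<cdot>\<^bsub>D\<^esub> \<xi> X"
  have f: "f \<in> Hom D X Y"
    using X Y h by (simp add: f_def right.hom_iff)
  \<comment> \<open>Linearity of \<open>h\<close> moves it past the counit.\<close>
  have "amap G f = h \<cdot>\<^bsub>C\<^esub> amap G (\<epsilon> X) \<cdot>\<^bsub>C\<^esub> amap G (\<xi> X)"
    using X Y h left.comp_tail[OF h(5)] by (simp add: f_def)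
  also have "\<dots> = h"
    using X h arg_cong[OF counit_section[OF X], of "amap G"] by simp
  finally show "\<exists>f \<in> Hom D X Y. amap K f = x"
    using f h(1) by (auto simp: amap_comparison)
qed

lemma equivalence_up_to_retracts_comparison:
  "equivalence_up_to_retracts D (Mod C M) K"
proof (rule equivalence_up_to_retractsI[OF is_functor_comparison fully_faithful_comparison])
  interpret split_monad C M "\<lambda>X. amap G (\<xi> (omap F X))" by (rule split_monad)
  fix N assume "N \<in> Obj (Mod C M)"
  then obtain X l where N: "N = (X, l)" "(X, l) \<in> modules C M" by (cases N) (simp add: Obj_Mod)
  then have X: "X \<in> Obj C" by (simp add: monad.modules_iff)
  have "is_retract (Mod C M) N (omap K (omap F X))"
    using module_retract_of_free[OF N(2)] by (simp add: N(1))
  then show "\<exists>Y \<in> Obj D. is_retract (Mod C M) N (omap K Y)"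
    using X by auto
qed

end

section \<open>Separability of the right adjoint\<close>

locale hom_retraction = is_functor D C G
  for D :: "('o2, 'm2) cat" and C :: "('o1, 'm1) cat" and G +
  fixes H :: "'o2 \<Rightarrow> 'o2 \<Rightarrow> 'm1 \<Rightarrow> 'm2"
  assumes retraction_hom: "X \<in> Obj D \<Longrightarrow> Y \<in> Obj D \<Longrightarrow> h \<in> Hom C (omap G X) (omap G Y) \<Longrightarrow>
      H X Y h \<in> Hom D X Y"
    and natural_source: "a \<in> Hom D X' X \<Longrightarrow> Y \<in> Obj D \<Longrightarrow> h \<in> Hom C (omap G X) (omap G Y) \<Longrightarrow>
      H X' Y (h \<cdot>\<^bsub>C\<^esub> amap G a) = H X Y h \<cdot>\<^bsub>D\<^esub> a"
    and natural_target: "X \<in> Obj D \<Longrightarrow> b \<in> Hom D Y Y' \<Longrightarrow> h \<in> Hom C (omap G X) (omap G Y) \<Longrightarrow>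
      H X Y' (amap G b \<cdot>\<^bsub>C\<^esub> h) = b \<cdot>\<^bsub>D\<^esub> H X Y h"
    and retraction: "f \<in> Hom D X Y \<Longrightarrow> H X Y (amap G f) = f"

lemma separable_functor_iff: "separable_functor D C G \<longleftrightarrow> (\<exists>H. hom_retraction D C G H)"
proof (cases "is_functor D C G")
  case True
  then interpret G: is_functor D C G .
  show ?thesis
    unfolding separable_functor_def hom_retraction_def hom_retraction_axioms_def
    using True by (intro iffI; elim conjE exE; intro conjI exI allI impI ballI) (blast dest: G.dom.hom_obj)+
qed (auto simp: separable_functor_def hom_retraction_def)

context adjunction
begin

text \<open>
  Naturality of \<open>H\<close> in the target gives \<open>\<epsilon>\<^sub>Y \<cdot> H(\<eta>\<^bsub>G Y\<^esub>) = H(G \<epsilon>\<^sub>Y \<cdot> \<eta>\<^bsub>G Y\<^esub>) = H(1) = 1\<close> by a triangle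
  identity. Naturality in both variables and naturality of \<open>\<eta>\<close> make \<open>H(\<eta>\<^bsub>G Y\<^esub>)\<close> natural in \<open>Y\<close>.
\<close>

lemma separable_right_adjoint_imp_split_counit:
  assumes "separable_functor D C G"
  obtains \<xi> where "split_counit C D F G \<eta> \<epsilon> \<xi>"
proof -
  obtain H where "hom_retraction D C G H" using assms by (auto simp: separable_functor_iff)
  then interpret H: hom_retraction D C G H .
  define \<xi> where "\<xi> Y = H Y (omap F (omap G Y)) (\<eta> (omap G Y))" for Y
  have \<eta>: "\<eta> (omap G Y) \<in> Hom C (omap G Y) (omap G (omap F (omap G Y)))" if "Y \<in> Obj D" for Y
    using that by (simp add: left.hom_iff)
  have "split_counit C D F G \<eta> \<epsilon> \<xi>"
  proof
    fix X assume "X \<in> Obj D"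
    then show "\<xi> X \<in> Hom D (omap id_func X) (omap (F \<circ>\<^sub>F G) X)"
      using H.retraction_hom[OF _ _ \<eta>] by (simp add: \<xi>_def)
  next
    fix f X Y assume f: "f \<in> Hom D X Y"
    have X: "X \<in> Obj D" and Y: "Y \<in> Obj D" using right.hom_obj[OF f] by auto
    have "\<xi> Y \<cdot>\<^bsub>D\<^esub> f = H X (omap F (omap G Y)) (\<eta> (omap G Y) \<cdot>\<^bsub>C\<^esub> amap G f)"
      using H.natural_source[OF f _ \<eta>[OF Y]] Y by (simp add: \<xi>_def)
    also have "\<eta> (omap G Y) \<cdot>\<^bsub>C\<^esub> amap G f = amap G (amap F (amap G f)) \<cdot>\<^bsub>C\<^esub> \<eta> (omap G X)"
      using unit.naturality[OF G.amap_hom[OF f]] by simp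
    also have "H X (omap F (omap G Y)) \<dots> = amap F (amap G f) \<cdot>\<^bsub>D\<^esub> \<xi> X"
      using H.natural_target[OF X F.amap_hom[OF G.amap_hom[OF f]] \<eta>[OF X]] by (simp add: \<xi>_def)
    finally show "\<xi> Y \<cdot>\<^bsub>D\<^esub> amap id_func f = amap (F \<circ>\<^sub>F G) f \<cdot>\<^bsub>D\<^esub> \<xi> X"
      by simp
  next
    fix Y assume Y: "Y \<in> Obj D"
    have "\<epsilon> Y \<cdot>\<^bsub>D\<^esub> \<xi> Y = H Y Y (amap G (\<epsilon> Y) \<cdot>\<^bsub>C\<^esub> \<eta> (omap G Y))"
      using H.natural_target[OF Y _ \<eta>[OF Y], of "\<epsilon> Y"] counit.component[OF Y] by (simp add: \<xi>_def)
    also have "\<dots> = \<one>\<^bsub>D\<^esub> Y"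
      using H.retraction[OF right.id_hom[OF Y]] Y by (simp add: triangle_right)
    finally show "\<epsilon> Y \<cdot>\<^bsub>D\<^esub> \<xi> Y = \<one>\<^bsub>D\<^esub> Y" .
  qed
  then show thesis by (rule that)
qed

text \<open>
  The underlying morphism of \<open>K f\<close> is \<open>G f\<close>, so the naturality of linearization in modules becomes
  naturality in \<open>D\<close> once it is pulled back along the bijection of \<open>K\<close> on hom-sets.
\<close>

lemma separable_right_adjointI:
  assumes "separable_monad C M" and ff: "fully_faithful D (Mod C M) K"
  shows "separable_functor D C G"
proof -
  obtain \<sigma> where "split_monad C M \<sigma>" using assms(1) by (auto simp: separable_monad_iff)
  then interpret split: split_monad C M \<sigma> .
  define lin where "lin X Y = split.linearize (omap K X) (omap K Y)" for X Y
  define H where "H X Y h = hom_lift D K X Y (omap K X, lin X Y h, omap K Y)" for X Y h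
  have H: "H X Y h \<in> Hom D X Y" and G_H: "amap G (H X Y h) = lin X Y h"
    if XY: "X \<in> Obj D" "Y \<in> Obj D" and h: "h \<in> Hom C (omap G X) (omap G Y)" for X Y h
  proof -
    have "(omap K X, lin X Y h, omap K Y) \<in> Hom (Mod C M) (omap K X) (omap K Y)"
      using XY h split.linearize_hom[of "omap K X" "omap K Y" h]
      by (simp add: lin_def comparison_module)
    note lift = hom_lift[OF ff XY this, folded H_def]
    show "H X Y h \<in> Hom D X Y" by (rule lift)
    then show "amap G (H X Y h) = lin X Y h" using lift(2) by (simp add: amap_comparison)
  qed
  have H_eqI: "H X Y h = f"
    if h: "h \<in> Hom C (omap G X) (omap G Y)" and f: "f \<in> Hom D X Y" and eq: "amap G f = lin X Y h"
    for X Y h f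
  proof -
    have XY: "X \<in> Obj D" "Y \<in> Obj D" using right.hom_obj[OF f] by auto
    have "amap K (H X Y h) = amap K f"
      using G_H[OF XY h] eq by (simp add: amap_comparison[OF f] amap_comparison[OF H[OF XY h]])
    then show ?thesis
      by (rule fully_faithful_faithful[OF ff right.category_axioms H[OF XY h] f])
  qed
  have "hom_retraction D C G H"
  proof
    fix X' X Y a h
    assume a: "a \<in> Hom D X' X" and Y: "Y \<in> Obj D" and h: "h \<in> Hom C (omap G X) (omap G Y)"
    have X: "X \<in> Obj D" using right.hom_obj[OF a] by simp
    have "amap G (H X Y h \<cdot>\<^bsub>D\<^esub> a) = lin X Y h \<cdot>\<^bsub>C\<^esub> amap G a"
      using G.amap_comp[OF a H[OF X Y h]] G_H[OF X Y h] by simp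
    also have "\<dots> = lin X' Y (h \<cdot>\<^bsub>C\<^esub> amap G a)"
      using split.linearize_natural_source[OF comparison_hom[OF a], of "omap K Y" h] h Y
      by (simp add: comparison_module lin_def)
    finally show "H X' Y (h \<cdot>\<^bsub>C\<^esub> amap G a) = H X Y h \<cdot>\<^bsub>D\<^esub> a"
      by (rule H_eqI[OF left.comp_hom[OF G.amap_hom[OF a] h] right.comp_hom[OF a H[OF X Y h]]])
  next
    fix X Y Y' b h
    assume X: "X \<in> Obj D" and b: "b \<in> Hom D Y Y'" and h: "h \<in> Hom C (omap G X) (omap G Y)"
    have Y: "Y \<in> Obj D" using right.hom_obj[OF b] by simp
    have "amap G (b \<cdot>\<^bsub>D\<^esub> H X Y h) = amap G b \<cdot>\<^bsub>C\<^esub> lin X Y h"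
      using G.amap_comp[OF H[OF X Y h] b] G_H[OF X Y h] by simp
    also have "\<dots> = lin X Y' (amap G b \<cdot>\<^bsub>C\<^esub> h)"
      using split.linearize_natural_target[OF _ comparison_hom[OF b], of "omap K X" h] h X
      by (simp add: comparison_module lin_def)
    finally show "H X Y' (amap G b \<cdot>\<^bsub>C\<^esub> h) = b \<cdot>\<^bsub>D\<^esub> H X Y h"
      by (rule H_eqI[OF left.comp_hom[OF h G.amap_hom[OF b]] right.comp_hom[OF H[OF X Y h] b]])
  next
    fix X Y f assume f: "f \<in> Hom D X Y"
    show "H X Y (amap G f) = f"
      using H_eqI[OF G.amap_hom[OF f] f] split.linearize_linear[OF comparison_hom[OF f]]
      by (simp add: lin_def)
  qed (rule H)
  then show ?thesis by (auto simp: separable_functor_iff)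
qed

end

theorem proposition3p5:
  fixes C :: "('o1, 'm1) cat" and D :: "('o2, 'm2) cat"
    and F :: "('o1, 'm1, 'o2, 'm2) func" and G :: "('o2, 'm2, 'o1, 'm1) func"
    and \<eta> :: "'o1 \<Rightarrow> 'm1" and \<epsilon> :: "'o2 \<Rightarrow> 'm2"
  assumes "category C" and "category D" and "adjunction C D F G \<eta> \<epsilon>"
  shows "separable_functor D C G \<longleftrightarrow>
    separable_monad C (adjunction_monad F G \<eta> \<epsilon>) \<and>
    equivalence_up_to_retracts D (Mod C (adjunction_monad F G \<eta> \<epsilon>)) (comparison D G \<epsilon>)"
proof
  interpret adjunction C D F G \<eta> \<epsilon> by fact
  show "separable_monad C M \<and> equivalence_up_to_retracts D (Mod C M) K"
    if "separable_functor D C G"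
  proof -
    obtain \<xi> where "split_counit C D F G \<eta> \<epsilon> \<xi>"
      using separable_right_adjoint_imp_split_counit[OF \<open>separable_functor D C G\<close>] .
    then interpret split_counit C D F G \<eta> \<epsilon> \<xi> .
    show ?thesis
      using split_monad equivalence_up_to_retracts_comparison separable_monad_iff by blast
  qed
  show "separable_functor D C G"
    if "separable_monad C M \<and> equivalence_up_to_retracts D (Mod C M) K"
    using that separable_right_adjointI equivalence_up_to_retracts_imp_fully_faithful by blast
qed

end
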